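(* Assume that $f\ge 0$ and $g$ are bounded in the $L_\infty$ norm. Given that the matrix $\mathbf A(a_h,\theta_h)$ of the mixed discretization (defined in the context) is an M-matrix for all admissible controls $(a_h,\theta_h)\in\Gamma$, the solution $u_h$ of the nonlinear discrete system $$\max_{(a_h,\theta_h)\in\Gamma}\{\mathbf A(a_h,\theta_h)\,u_h-F_h(a_h,\theta_h)\}=0$$ is bounded by $$\|u_h\|_\infty\le\tfrac12\|\sqrt f\|_\infty R^2+\|g\|_\infty,\qquad R=\max_{(x,y)\in\overline\Omega}\sqrt{x^2+y^2},$$ where the bound is independent of the mesh size $h$ and of the controls $(a_h,\theta_h)$.
   Context: **Setting.** $\Omega\subset\mathbb R^2$ is a bounded convex open set, $f:\Omega\to\mathbb R$ with $f\ge0$, $g:\partial\Omega\to\mathbb R$. $\Gamma=[0,1]\times[-\frac\pi4,\frac\pi4)$ and, for $(a,\theta)\in\Gamma$, $\alpha_{11}=\frac12[1-(1-2a)\cos2\theta]$, $\alpha_{22}=\frac12[1+(1-2a)\cos2\theta]$, $\alpha_{12}=\frac12(1-2a)\sin2\theta$. **Grid.** An $N\times N$ square grid of mesh size $h$ with points $\mathbf x_{i,j}=(x_i,y_j)$, $0\le i,j\le N+1$; $\mathbf x_{i,j}\in\Omega$ for $1\le i,j\le N$, and $\mathbf x_{i,j}\in\partial\Omega$ if $i$ or $j$ is in $\{0,N+1\}$ (so $\Omega$ is an open axis-parallel square). The unknown is $u_h=(u_{1,1},u_{1,2},\dots,u_{N,N})^T\in\mathbb R^{N^2}$; at boundary grid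 points $u_{i,j}=g(\mathbf x_{i,j})$. **Scheme at an interior grid point $\mathbf x_{i,j}$ with control $(a,\theta)\in\Gamma$.** (i) If $\alpha_{11}\ge|\alpha_{12}|$ and $\alpha_{22}\ge|\alpha_{12}|$ (standard 7-point stencil), set $\mathcal L_{i,j}(a,\theta;u_h)=-\alpha_{11}\delta_{xx}u-2\alpha_{12}\delta_{xy}u-\alpha_{22}\delta_{yy}u+2\sqrt{a(1-a)f(\mathbf x_{i,j})}$, where $\delta_{xx}u=(u_{i+1,j}-2u_{i,j}+u_{i-1,j})/h^2$, $\delta_{yy}u=(u_{i,j+1}-2u_{i,j}+u_{i,j-1})/h^2$, and $\delta_{xy}u=\frac{1}{2h^2}(2u_{i,j}+u_{i+1,j+1}+u_{i-1,j-1}-u_{i+1,j}-u_{i-1,j}-u_{i,j+1}-u_{i,j-1})$ if $\alpha_{12}\ge0$, $\delta_{xy}u=\frac{1}{2h^2}(-2u_{i,j}-u_{i+1,j-1}-u_{i-1,j+1}+u_{i+1,j}+u_{i-1,j}+u_{i,j+1}+u_{i,j-1})$ if $\alpha_{12}\le0$. (ii) Otherwise (semi-Lagrangian wide stencil), let $\mathbf e_z=(\cos\theta,-\sin\theta)$, $\mathbf e_w=(\sin\theta,\cos\theta)$ and set $\mathcal L_{i,j}(a,\theta;u_h)=-a\,\delta_{zz}u-(1-a)\,\delta_{ww}u+2\sqrt{a(1-a)f(\mathbf x_{i,j})}$, where for $\mathbf e=\mathbf e_z$ (respectively $\mathbf e_w$) $\delta_{\mathbf e\mathbf e}u=\frac{2}{\eta_++\eta_-}\Big(\frac{v_+-u_{i,j}}{\eta_+}-\frac{u_{i,j}-v_-}{\eta_-}\Big)$.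 If $\mathbf x_{i,j}\pm\sqrt h\,\mathbf e\in\overline\Omega$, then $\eta_\pm=\sqrt h$ and $v_\pm=\mathcal I_hu$ evaluated at $\mathbf x_{i,j}\pm\sqrt h\,\mathbf e$, with $\mathcal I_h$ the bilinear interpolation from the four surrounding grid points. Otherwise $\eta_\pm\in(0,\sqrt h)$ is such that $\mathbf x_{i,j}\pm\eta_\pm\mathbf e\in\partial\Omega$, and $v_\pm=g(\mathbf x_{i,j}\pm\eta_\pm\mathbf e)$. **Matrix form.** Controls $(a_h,\theta_h)$ assign to each interior grid point a pair $(a_{i,j},\theta_{i,j})\in\Gamma$ (this is what $(a_h,\theta_h)\in\Gamma$ means). $\mathbf A(a_h,\theta_h)\in\mathbb R^{N^2\times N^2}$ and $F_h(a_h,\theta_h)\in\mathbb R^{N^2}$ are defined by $\mathcal L_{i,j}(a_{i,j},\theta_{i,j};u_h)=(\mathbf A(a_h,\theta_h)u_h-F_h(a_h,\theta_h))_{i,j}$, where $\mathbf A$ collects the coefficients of the unknowns at interior grid points and $F_h$ all the remaining terms (including boundary values). The max of a vector is taken componentwise, row $(i,j)$ depending only on $(a_{i,j},\theta_{i,j})$, and is understood as a supremum. An M-matrix is a non-singular matrix with positive diagonal entries, non-positive off-diagonal entries, and entrywise non-negative inverse. $\|f\|_\infty$, $\|g\|_\infty$ and $\|u_h\|_\infty$ are sup norms over $\Omega$, $\partial\Omega$ and the entries, respectively. *)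

theory Defs
  imports
    "HOL-Analysis.Convex"
    "HOL-Analysis.Topology_Euclidean_Space"
    "HOL-Library.Extended_Real"
    "Jordan_Normal_Form.Matrix"
begin

definition sup_norm_on :: "'a set \<Rightarrow> ('a \<Rightarrow> real) \<Rightarrow> real" where
  "sup_norm_on S \<phi> = (SUP x\<in>S. \<bar>\<phi> x\<bar>)"

text \<open>The last conjunct concerns the inverse, which exists by the first one and is unique.\<close>

definition M_matrix :: "real mat \<Rightarrow> bool" where
  "M_matrix A \<longleftrightarrow> invertible_mat A
     \<and> (\<forall>i<dim_row A. 0 < A $$ (i, i))
     \<and> (\<forall>i<dim_row A. \<forall>j<dim_col A. i \<noteq> j \<longrightarrow> A $$ (i, j) \<le> 0)
     \<and> (\<forall>B. inverts_mat A B \<and> inverts_mat B A \<longrightarrow>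
           (\<forall>i<dim_row B. \<forall>j<dim_col B. 0 \<le> B $$ (i, j)))"


section \<open>Controls\<close>

definition control_set :: "(real \<times> real) set" where
  "control_set = {0..1} \<times> {- (pi / 4)..<pi / 4}"

definition alpha11 :: "real \<Rightarrow> real \<Rightarrow> real" where
  "alpha11 a \<theta> = 1 / 2 * (1 - (1 - 2 * a) * cos (2 * \<theta>))"

definition alpha22 :: "real \<Rightarrow> real \<Rightarrow> real" where
  "alpha22 a \<theta> = 1 / 2 * (1 + (1 - 2 * a) * cos (2 * \<theta>))"

definition alpha12 :: "real \<Rightarrow> real \<Rightarrow> real" where
  "alpha12 a \<theta> = 1 / 2 * (1 - 2 * a) * sin (2 * \<theta>)"

text \<open>A discrete control assigns a pair \<open>(a, \<theta>)\<close> to each interior grid index.\<close>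

definition admissible_controls :: "nat \<Rightarrow> (nat \<times> nat \<Rightarrow> real \<times> real) set" where
  "admissible_controls N = {c. \<forall>i\<in>{1..N}. \<forall>j\<in>{1..N}. c (i, j) \<in> control_set}"


section \<open>Grid\<close>

text \<open>\<open>p\<close> is the lower left corner of the square, \<open>h\<close> the mesh size.\<close>

definition grid_point :: "real \<times> real \<Rightarrow> real \<Rightarrow> nat \<Rightarrow> nat \<Rightarrow> real \<times> real" where
  "grid_point p h i j = (fst p + real i * h, snd p + real j * h)"

definition square_grid :: "(real \<times> real) set \<Rightarrow> real \<times> real \<Rightarrow> real \<Rightarrow> nat \<Rightarrow> bool" where
  "square_grid \<Omega> p h N \<longleftrightarrow> 1 \<le> N \<and> 0 < h \<and>
     \<Omega> = {fst p<..<fst p + real (N + 1) * h} \<times> {snd p<..<snd p + real (N + 1) * h}"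

text \<open>Position of the unknown \<open>u\<^sub>i\<^sub>,\<^sub>j\<close> in the vector
  \<open>(u\<^sub>1\<^sub>,\<^sub>1, u\<^sub>1\<^sub>,\<^sub>2, \<dots>, u\<^sub>N\<^sub>,\<^sub>N)\<close>, counted from \<open>0\<close>, and its inverse.\<close>

definition row_of :: "nat \<Rightarrow> nat \<times> nat \<Rightarrow> nat" where
  "row_of N = (\<lambda>(i, j). (i - 1) * N + (j - 1))"

definition node_of :: "nat \<Rightarrow> nat \<Rightarrow> nat \<times> nat" where
  "node_of N k = (k div N + 1, k mod N + 1)"


section \<open>The mixed discretization\<close>

text \<open>Below, \<open>U :: nat \<Rightarrow> nat \<Rightarrow> real\<close> is a grid function on the indices \<open>0, \<dots>, N + 1\<close>,
  boundary indices included.\<close>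

definition delta_xx :: "real \<Rightarrow> (nat \<Rightarrow> nat \<Rightarrow> real) \<Rightarrow> nat \<Rightarrow> nat \<Rightarrow> real" where
  "delta_xx h U i j = (U (i + 1) j - 2 * U i j + U (i - 1) j) / h\<^sup>2"

definition delta_yy :: "real \<Rightarrow> (nat \<Rightarrow> nat \<Rightarrow> real) \<Rightarrow> nat \<Rightarrow> nat \<Rightarrow> real" where
  "delta_yy h U i j = (U i (j + 1) - 2 * U i j + U i (j - 1)) / h\<^sup>2"

text \<open>The argument \<open>\<alpha>\<close> selects the stencil. At \<open>\<alpha> = 0\<close> both apply; there the mixed
  difference is only used with the factor \<open>\<alpha>\<close>.\<close>

definition delta_xy ::
  "real \<Rightarrow> real \<Rightarrow> (nat \<Rightarrow> nat \<Rightarrow> real) \<Rightarrow> nat \<Rightarrow> nat \<Rightarrow> real" where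
  "delta_xy h \<alpha> U i j =
     (if 0 \<le> \<alpha> then
        1 / (2 * h\<^sup>2) * (2 * U i j + U (i + 1) (j + 1) + U (i - 1) (j - 1)
          - U (i + 1) j - U (i - 1) j - U i (j + 1) - U i (j - 1))
      else
        1 / (2 * h\<^sup>2) * (- 2 * U i j - U (i + 1) (j - 1) - U (i - 1) (j + 1)
          + U (i + 1) j + U (i - 1) j + U i (j + 1) + U i (j - 1)))"

definition bilinear ::
  "real \<times> real \<Rightarrow> real \<Rightarrow> nat \<Rightarrow> (nat \<Rightarrow> nat \<Rightarrow> real) \<Rightarrow> real \<times> real \<Rightarrow> real" where
  "bilinear p h N U z =
     (let i = min N (nat \<lfloor>(fst z - fst p) / h\<rfloor>);
          j = min N (nat \<lfloor>(snd z - snd p) / h\<rfloor>);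
          s = (fst z - fst p) / h - real i;
          t = (snd z - snd p) / h - real j
      in (1 - s) * (1 - t) * U i j + s * (1 - t) * U (i + 1) j
         + (1 - s) * t * U i (j + 1) + s * t * U (i + 1) (j + 1))"

context
  fixes \<Omega> :: "(real \<times> real) set"
    and p :: "real \<times> real" and h :: real and N :: nat
    and f g :: "real \<times> real \<Rightarrow> real"
begin

text \<open>\<open>arm x e\<close> and \<open>arm_value U x e\<close> are the step \<open>\<eta>\<close> from \<open>x\<close> in direction \<open>e\<close> and the value
  used at its end point; the backward step is the one in direction \<open>- e\<close>.\<close>

definition arm :: "real \<times> real \<Rightarrow> real \<times> real \<Rightarrow> real" where
  "arm x e = (if x + sqrt h *\<^sub>R e \<in> closure \<Omega> then sqrt h
     else (THE \<eta>. 0 < \<eta> \<and> \<eta> < sqrt h \<and> x + \<eta> *\<^sub>R e \<in> frontier \<Omega>))"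

definition arm_value ::
  "(nat \<Rightarrow> nat \<Rightarrow> real) \<Rightarrow> real \<times> real \<Rightarrow> real \<times> real \<Rightarrow> real" where
  "arm_value U x e = (if x + sqrt h *\<^sub>R e \<in> closure \<Omega>
     then bilinear p h N U (x + sqrt h *\<^sub>R e)
     else g (x + arm x e *\<^sub>R e))"

definition delta_dir ::
  "(nat \<Rightarrow> nat \<Rightarrow> real) \<Rightarrow> real \<times> real \<Rightarrow> nat \<Rightarrow> nat \<Rightarrow> real" where
  "delta_dir U e i j =
     (let x = grid_point p h i j; \<eta>\<^sub>p = arm x e; \<eta>\<^sub>m = arm x (- e)
      in 2 / (\<eta>\<^sub>p + \<eta>\<^sub>m) *
         ((arm_value U x e - U i j) / \<eta>\<^sub>p - (U i j - arm_value U x (- e)) / \<eta>\<^sub>m))"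

definition discrete_op ::
  "real \<times> real \<Rightarrow> (nat \<Rightarrow> nat \<Rightarrow> real) \<Rightarrow> nat \<Rightarrow> nat \<Rightarrow> real" where
  "discrete_op c U i j =
     (case c of (a, \<theta>) \<Rightarrow>
       (if \<bar>alpha12 a \<theta>\<bar> \<le> alpha11 a \<theta> \<and> \<bar>alpha12 a \<theta>\<bar> \<le> alpha22 a \<theta> then
          - alpha11 a \<theta> * delta_xx h U i j
          - 2 * alpha12 a \<theta> * delta_xy h (alpha12 a \<theta>) U i j
          - alpha22 a \<theta> * delta_yy h U i j
          + 2 * sqrt (a * (1 - a) * f (grid_point p h i j))
        else
          - a * delta_dir U (cos \<theta>, - sin \<theta>) i j
          - (1 - a) * delta_dir U (sin \<theta>, cos \<theta>) i j
          + 2 * sqrt (a * (1 - a) * f (grid_point p h i j))))"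

definition grid_fun :: "real vec \<Rightarrow> nat \<Rightarrow> nat \<Rightarrow> real" where
  "grid_fun u i j = (if i \<in> {1..N} \<and> j \<in> {1..N} then u $ row_of N (i, j)
     else g (grid_point p h i j))"

definition scheme :: "real \<times> real \<Rightarrow> real vec \<Rightarrow> nat \<times> nat \<Rightarrow> real" where
  "scheme c u = (\<lambda>(i, j). discrete_op c (grid_fun u) i j)"

text \<open>The scheme is affine in the unknowns. Its coefficients and its constant part are read off
  at the unit vectors and at \<open>0\<close>; see \<open>scheme_matrix_form\<close> below.\<close>

definition scheme_matrix :: "(nat \<times> nat \<Rightarrow> real \<times> real) \<Rightarrow> real mat" where
  "scheme_matrix c = mat (N * N) (N * N) (\<lambda>(k, l).
     scheme (c (node_of N k)) (unit_vec (N * N) l) (node_of N k)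
     - scheme (c (node_of N k)) (0\<^sub>v (N * N)) (node_of N k))"

definition scheme_rhs :: "(nat \<times> nat \<Rightarrow> real \<times> real) \<Rightarrow> real vec" where
  "scheme_rhs c = vec (N * N) (\<lambda>k.
     - scheme (c (node_of N k)) (0\<^sub>v (N * N)) (node_of N k))"

text \<open>The componentwise supremum is taken in \<^typ>\<open>ereal\<close>, so that it vanishes only if it is
  a genuine supremum.\<close>

definition discrete_solution :: "real vec \<Rightarrow> bool" where
  "discrete_solution u \<longleftrightarrow> u \<in> carrier_vec (N * N) \<and>
     (\<forall>k<N * N. (SUP c\<in>admissible_controls N.
        ereal ((scheme_matrix c *\<^sub>v u - scheme_rhs c) $ k)) = 0)"


section \<open>Consistency of the definitions\<close>

lemma square_grid_fits:
  assumes "square_grid \<Omega> p h N"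
  shows "open \<Omega>" "bounded \<Omega>" "convex \<Omega>"
    and "i \<in> {1..N} \<Longrightarrow> j \<in> {1..N} \<Longrightarrow> grid_point p h i j \<in> \<Omega>"
    and "i \<le> N + 1 \<Longrightarrow> j \<le> N + 1 \<Longrightarrow> i \<in> {0, N + 1} \<or> j \<in> {0, N + 1} \<Longrightarrow>
      grid_point p h i j \<in> frontier \<Omega>"
proof -
  have h: "0 < h" and \<Omega>: "\<Omega> = {fst p<..<fst p + real (N + 1) * h} \<times>
      {snd p<..<snd p + real (N + 1) * h}"
    using assms by (auto simp: square_grid_def)
  have L: "0 < real (N + 1) * h" using h by simp
  show op: "open \<Omega>" unfolding \<Omega> by (intro open_Times) auto
  show "bounded \<Omega>" unfolding \<Omega>
    by (intro bounded_Times bounded_subset[OF compact_imp_bounded[OF compact_Icc]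
          greaterThanLessThan_subseteq_atLeastAtMost_iff[THEN iffD2]]) auto
  show "convex \<Omega>" unfolding \<Omega> by (intro convex_Times convex_real_interval)
  show "grid_point p h i j \<in> \<Omega>" if "i \<in> {1..N}" "j \<in> {1..N}"
    using that h unfolding \<Omega> grid_point_def by (auto intro!: mult_strict_right_mono)
  have cl: "closure \<Omega> = {fst p..fst p + real (N + 1) * h} \<times> {snd p..snd p + real (N + 1) * h}"
    unfolding \<Omega> closure_Times using L by (subst (1 2) closure_greaterThanLessThan) auto
  show "grid_point p h i j \<in> frontier \<Omega>"
    if "i \<le> N + 1" "j \<le> N + 1" "i \<in> {0, N + 1} \<or> j \<in> {0, N + 1}"
  proof -
    have "real i * h \<le> real (N + 1) * h" "real j * h \<le> real (N + 1) * h"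
      using that(1,2) h by (auto intro!: mult_right_mono)
    then have "grid_point p h i j \<in> closure \<Omega>"
      using h unfolding cl grid_point_def by auto
    moreover have "grid_point p h i j \<notin> \<Omega>"
      using that(3) unfolding \<Omega> grid_point_def by auto
    ultimately show ?thesis using op by (simp add: frontier_def interior_open)
  qed
qed

lemma node_row:
  assumes "i \<in> {1..N}" "j \<in> {1..N}"
  shows "row_of N (i, j) < N * N" "node_of N (row_of N (i, j)) = (i, j)"
proof -
  obtain i' j' where ij: "i = Suc i'" "j = Suc j'" "i' < N" "j' < N"
    using assms by (cases i; cases j) auto
  have "i' * N + j' < Suc i' * N" using ij by simp
  also have "\<dots> \<le> N * N" using ij by (intro mult_le_mono) auto
  finally show "row_of N (i, j) < N * N" using ij by (simp add: row_of_def)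
  show "node_of N (row_of N (i, j)) = (i, j)" using ij by (simp add: row_of_def node_of_def)
qed

lemma row_node: "k < N * N \<Longrightarrow> row_of N (node_of N k) = k"
  by (simp add: row_of_def node_of_def)

definition affine_vec :: "(real vec \<Rightarrow> real) \<Rightarrow> bool" where
  "affine_vec \<phi> \<longleftrightarrow> (\<exists>b w. \<forall>u\<in>carrier_vec (N * N). \<phi> u = b + (\<Sum>l<N * N. w l * u $ l))"

lemma affine_vec_const: "affine_vec (\<lambda>_. b)"
  unfolding affine_vec_def by (intro exI[of _ b] exI[of _ "\<lambda>_. 0"]) auto

lemma affine_vec_add:
  assumes "affine_vec \<phi>" "affine_vec \<psi>" shows "affine_vec (\<lambda>u. \<phi> u + \<psi> u)"
proof -
  obtain b w where 1: "\<And>u. u \<in> carrier_vec (N * N) \<Longrightarrow> \<phi> u = b + (\<Sum>l<N * N. w l * u $ l)"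
    using assms(1) unfolding affine_vec_def by auto
  obtain b' w' where 2: "\<And>u. u \<in> carrier_vec (N * N) \<Longrightarrow> \<psi> u = b' + (\<Sum>l<N * N. w' l * u $ l)"
    using assms(2) unfolding affine_vec_def by auto
  show ?thesis unfolding affine_vec_def
    by (intro exI[of _ "b + b'"] exI[of _ "\<lambda>l. w l + w' l"])
       (auto simp: 1 2 sum.distrib distrib_right)
qed

lemma affine_vec_cmult:
  assumes "affine_vec \<phi>" shows "affine_vec (\<lambda>u. r * \<phi> u)"
proof -
  obtain b w where 1: "\<And>u. u \<in> carrier_vec (N * N) \<Longrightarrow> \<phi> u = b + (\<Sum>l<N * N. w l * u $ l)"
    using assms(1) unfolding affine_vec_def by auto
  show ?thesis unfolding affine_vec_def
    by (intro exI[of _ "r * b"] exI[of _ "\<lambda>l. r * w l"])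
       (auto simp: 1 distrib_left sum_distrib_left mult.assoc)
qed

lemma affine_vec_diff:
  "affine_vec \<phi> \<Longrightarrow> affine_vec \<psi> \<Longrightarrow> affine_vec (\<lambda>u. \<phi> u - \<psi> u)"
  using affine_vec_add[of \<phi>, OF _ affine_vec_cmult[of \<psi> "- 1"]] by simp

lemma affine_vec_divide: "affine_vec \<phi> \<Longrightarrow> affine_vec (\<lambda>u. \<phi> u / r)"
  using affine_vec_cmult[of \<phi> "1 / r"] by simp

lemmas affine_vec_intros =
  affine_vec_const affine_vec_add affine_vec_diff affine_vec_cmult affine_vec_divide

lemma affine_vec_grid_fun: "affine_vec (\<lambda>u. grid_fun u i j)"
proof (cases "i \<in> {1..N} \<and> j \<in> {1..N}")
  case True
  then have r: "row_of N (i, j) < N * N" using node_row by blast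
  show ?thesis unfolding affine_vec_def
    by (intro exI[of _ 0] exI[of _ "\<lambda>l. if l = row_of N (i, j) then 1 else 0"])
       (use True r in \<open>auto simp: grid_fun_def if_distrib[of "\<lambda>x. x * _"] cong: if_cong\<close>)
next
  case False
  then show ?thesis by (auto simp: grid_fun_def affine_vec_const)
qed

lemma affine_vec_arm_value: "affine_vec (\<lambda>u. arm_value (grid_fun u) x e)"
  by (cases "x + sqrt h *\<^sub>R e \<in> closure \<Omega>")
     (simp_all add: arm_value_def bilinear_def Let_def affine_vec_const,
      intro affine_vec_intros affine_vec_grid_fun)

lemma affine_vec_scheme: "affine_vec (\<lambda>u. scheme c u ij)"
proof -
  obtain a \<theta> where c: "c = (a, \<theta>)" by (cases c)
  obtain i j where ij: "ij = (i, j)" by (cases ij)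
  have xx: "affine_vec (\<lambda>u. delta_xx h (grid_fun u) i j)"
    unfolding delta_xx_def by (intro affine_vec_intros affine_vec_grid_fun)
  have yy: "affine_vec (\<lambda>u. delta_yy h (grid_fun u) i j)"
    unfolding delta_yy_def by (intro affine_vec_intros affine_vec_grid_fun)
  have xy: "affine_vec (\<lambda>u. delta_xy h r (grid_fun u) i j)" for r
    by (cases "0 \<le> r")
       (simp_all only: delta_xy_def if_True if_False, (intro affine_vec_intros affine_vec_grid_fun)+)
  have ee: "affine_vec (\<lambda>u. delta_dir (grid_fun u) e i j)" for e
    unfolding delta_dir_def Let_def
    by (intro affine_vec_intros affine_vec_grid_fun affine_vec_arm_value)
  show ?thesis
  proof (cases "\<bar>alpha12 a \<theta>\<bar> \<le> alpha11 a \<theta> \<and> \<bar>alpha12 a \<theta>\<bar> \<le> alpha22 a \<theta>")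
    case True
    show ?thesis unfolding scheme_def discrete_op_def c ij prod.case if_P[OF True]
      by (intro affine_vec_intros xx yy xy)
  next
    case False
    show ?thesis unfolding scheme_def discrete_op_def c ij prod.case if_not_P[OF False]
      by (intro affine_vec_intros ee)
  qed
qed

lemma scheme_matrix_form:
  assumes u: "u \<in> carrier_vec (N * N)" and i: "i \<in> {1..N}" and j: "j \<in> {1..N}"
  shows "(scheme_matrix c *\<^sub>v u - scheme_rhs c) $ row_of N (i, j) = scheme (c (i, j)) u (i, j)"
proof -
  define k where "k = row_of N (i, j)"
  have k: "k < N * N" "node_of N k = (i, j)" using node_row[OF i j] by (auto simp: k_def)
  obtain b w where 1: "\<And>v. v \<in> carrier_vec (N * N) \<Longrightarrow>
      scheme (c (i, j)) v (i, j) = b + (\<Sum>l<N * N. w l * v $ l)"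
    using affine_vec_scheme[of "c (i, j)" "(i, j)"] unfolding affine_vec_def by auto
  have b: "scheme (c (i, j)) (0\<^sub>v (N * N)) (i, j) = b" by (simp add: 1)
  have w: "scheme (c (i, j)) (unit_vec (N * N) l) (i, j) = b + w l" if "l < N * N" for l
    using that by (simp add: 1 unit_vec_def if_distrib[of "\<lambda>x. _ * x"] cong: if_cong)
  have "(scheme_matrix c *\<^sub>v u - scheme_rhs c) $ k = (\<Sum>l<N * N. w l * u $ l) + b"
    using k u by (auto simp: scheme_matrix_def scheme_rhs_def scalar_prod_def b w
        lessThan_atLeast0 intro!: sum.cong)
  then show ?thesis using 1[OF u] by (simp add: k_def)
qed

end

end

theory Submission
  imports Defs "HOL-Analysis.Starlike"
begin

text \<open>
  The bound is a discrete comparison with a paraboloid. Write \<open>q x = \<bar>x\<bar>\<^sup>2\<close>, let \<open>F\<close> and \<open>G\<close> be the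
  sup norms of \<open>\<surd>f\<close> and \<open>g\<close>, and let \<open>D\<^sub>c\<close> be the scheme with control \<open>c\<close> and without its source
  term, so that \<open>D\<^sub>c\<close> discretizes \<open>- tr (\<alpha> D\<^sup>2u)\<close>. Three properties of \<open>D\<^sub>c\<close> carry the proof.

  \<^item> It is linear in the grid values together with the boundary data, and it kills constants
    (\<open>diffusion_lincomb\<close>).

  \<^item> It is monotone: both stencils combine differences \<open>v - u\<^sub>i\<^sub>,\<^sub>j\<close> with non-positive weights, where
    \<open>v\<close> is a grid value, a convex combination of grid values, or a boundary value. Hence it is
    non-positive at a minimum (\<open>diffusion_nonpos_at_min\<close>), and a grid function that is non-negative
    on the boundary and satisfies \<open>D\<^sub>c > 0\<close> at each interior node, for some control depending on
    the node, is non-negative (\<open>discrete_minimum_principle\<close>).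

  \<^item> It satisfies \<open>D\<^sub>c q \<le> - 2\<close> (\<open>diffusion_sq_dist_le\<close>). The trace of \<open>\<alpha>\<close> is \<open>1\<close>, so the continuous
    value is exactly \<open>- 2\<close>. The 7-point stencil reproduces it. The wide stencil is exact on
    quadratics along each direction, and bilinear interpolation of a convex function overestimates
    it, which only helps.

  For \<open>K > F\<close> the barrier \<open>K / 2 * (R\<^sup>2 - q) + G\<close> dominates \<open>\<bar>g\<bar>\<close> on the boundary and has
  \<open>D\<^sub>c \<ge> K\<close>. The source lies between \<open>0\<close> and \<open>F\<close> because \<open>2 \<surd>(a (1 - a)) \<le> 1\<close>. That the supremum
  over the controls is zero means two things: for every control the scheme is at most \<open>0\<close>, so
  \<open>D\<^sub>c u \<le> 0 < K\<close>; and at each node some control makes the scheme larger than \<open>- (K - F)\<close>, so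
  \<open>D\<^sub>c u > - K\<close>. Comparing the barrier with \<open>u\<close> and with \<open>- u\<close> gives \<open>\<bar>u\<bar> \<le> K / 2 * R\<^sup>2 + G\<close>, and
  \<open>K\<close> may tend to \<open>F\<close>. The strict inequality \<open>K > F\<close> serves two ends: the supremum need not be
  attained, so only an almost optimal control is available, and the minimum principle asks for
  strict positivity.
\<close>

section \<open>Geometry of the grid\<close>

definition sq_dist :: "real \<times> real \<Rightarrow> real" where
  "sq_dist z = (fst z)\<^sup>2 + (snd z)\<^sup>2"

context
  fixes \<Omega> :: "(real \<times> real) set" and p :: "real \<times> real" and h :: real and N :: nat
  assumes grid: "square_grid \<Omega> p h N"
begin

lemma mesh_pos: "0 < h"
  using grid by (simp add: square_grid_def)

lemma closure_square:
  "closure \<Omega> = {fst p..fst p + real (N + 1) * h} \<times> {snd p..snd p + real (N + 1) * h}"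
proof -
  have \<Omega>: "\<Omega> = {fst p<..<fst p + real (N + 1) * h} \<times> {snd p<..<snd p + real (N + 1) * h}"
    using grid by (simp add: square_grid_def)
  have "0 < real (N + 1) * h" using mesh_pos by simp
  then show ?thesis
    unfolding \<Omega> closure_Times by (subst (1 2) closure_greaterThanLessThan) auto
qed

text \<open>The length of a cut-off arm is given by a definite description, so it is meaningful only once
  the boundary point on the ray is known to exist and to be unique. Existence is connectedness of
  the segment, uniqueness is convexity of the square.\<close>

lemma arm_cut_off:
  assumes x: "x \<in> \<Omega>" and out: "x + sqrt h *\<^sub>R e \<notin> closure \<Omega>"
  shows "0 < arm \<Omega> h x e" and "x + arm \<Omega> h x e *\<^sub>R e \<in> frontier \<Omega>"
proof -
  have op: "open \<Omega>" and conv: "convex \<Omega>"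
    using square_grid_fits(1,3)[OF grid] by auto
  have "\<exists>!\<eta>. 0 < \<eta> \<and> \<eta> < sqrt h \<and> x + \<eta> *\<^sub>R e \<in> frontier \<Omega>"
  proof (rule ex_ex1I)
    have "closed_segment x (x + sqrt h *\<^sub>R e) \<inter> frontier \<Omega> \<noteq> {}"
    proof (rule connected_Int_frontier)
      show "closed_segment x (x + sqrt h *\<^sub>R e) \<inter> \<Omega> \<noteq> {}"
        using x by auto
      show "closed_segment x (x + sqrt h *\<^sub>R e) - \<Omega> \<noteq> {}"
        using out closure_subset[of \<Omega>] by auto
    qed simp
    then obtain t where t: "0 \<le> t" "t \<le> 1"
      and "(1 - t) *\<^sub>R x + t *\<^sub>R (x + sqrt h *\<^sub>R e) \<in> frontier \<Omega>"
      by (auto simp: closed_segment_def)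
    then have fr: "x + (t * sqrt h) *\<^sub>R e \<in> frontier \<Omega>"
      by (simp add: algebra_simps)
    have "t \<noteq> 0" using fr x op by (auto simp: frontier_def interior_open)
    moreover have "t \<noteq> 1" using fr out by (auto simp: frontier_def)
    ultimately show "\<exists>\<eta>. 0 < \<eta> \<and> \<eta> < sqrt h \<and> x + \<eta> *\<^sub>R e \<in> frontier \<Omega>"
      using fr t mesh_pos by (intro exI[of _ "t * sqrt h"]) auto
  next
    \<comment> \<open>Points strictly between the interior point \<open>x\<close> and a point of the closure are interior.\<close>
    have below: False if "0 < \<eta>" "\<eta> < \<eta>'" "x + \<eta> *\<^sub>R e \<in> frontier \<Omega>" "x + \<eta>' *\<^sub>R e \<in> frontier \<Omega>"
      for \<eta> \<eta>'
    proof -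
      define t where "t = 1 - \<eta> / \<eta>'"
      have t: "0 < t" "t \<le> 1" using that by (auto simp: t_def field_simps)
      have "(x + \<eta>' *\<^sub>R e) - t *\<^sub>R ((x + \<eta>' *\<^sub>R e) - x) \<in> interior \<Omega>"
        using that(4) x op t
        by (intro mem_interior_closure_convex_shrink[OF conv]) (auto simp: frontier_def interior_open)
      moreover have "(x + \<eta>' *\<^sub>R e) - t *\<^sub>R ((x + \<eta>' *\<^sub>R e) - x) = x + (\<eta>' - t * \<eta>') *\<^sub>R e"
        by (simp add: algebra_simps)
      moreover have "\<eta>' - t * \<eta>' = \<eta>" using that by (simp add: t_def field_simps)
      ultimately have "x + \<eta> *\<^sub>R e \<in> interior \<Omega>" by metis
      then show False using that(3) by (simp add: frontier_def)
    qed
    fix \<eta> \<eta>'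
    assume "0 < \<eta> \<and> \<eta> < sqrt h \<and> x + \<eta> *\<^sub>R e \<in> frontier \<Omega>"
      and "0 < \<eta>' \<and> \<eta>' < sqrt h \<and> x + \<eta>' *\<^sub>R e \<in> frontier \<Omega>"
    then show "\<eta> = \<eta>'" using below by (metis linorder_neqE_linordered_idom)
  qed
  from theI'[OF this] show "0 < arm \<Omega> h x e" "x + arm \<Omega> h x e *\<^sub>R e \<in> frontier \<Omega>"
    using out by (auto simp: arm_def)
qed

lemma arm_pos: "x \<in> \<Omega> \<Longrightarrow> 0 < arm \<Omega> h x e"
  using arm_cut_off(1)[of x e] mesh_pos
  by (cases "x + sqrt h *\<^sub>R e \<in> closure \<Omega>") (auto simp: arm_def)

text \<open>The last cell absorbs \<open>\<xi> = N + 1\<close>, the only value in range whose integer part is not the index of a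
  cell; there the local coordinate is \<open>1\<close>.\<close>

lemma bilinear_cell:
  assumes "0 \<le> \<xi>" "\<xi> \<le> real (N + 1)" "i = min N (nat \<lfloor>\<xi>\<rfloor>)"
  shows "i \<le> N" "0 \<le> \<xi> - real i" "\<xi> - real i \<le> 1"
proof -
  show "i \<le> N" using assms by simp
  define n where "n = nat \<lfloor>\<xi>\<rfloor>"
  have "real n \<le> \<xi>" "\<xi> < real n + 1" unfolding n_def using assms(1) by linarith+
  moreover have "i = min N n" using assms(3) by (simp add: n_def)
  ultimately show "0 \<le> \<xi> - real i" "\<xi> - real i \<le> 1"
    using assms(2) by (auto simp: min_def split: if_splits)
qed

text \<open>Bilinear interpolation in cell coordinates \<open>(s, t)\<close>: its four weights are non-negative and sum
  to \<open>1\<close>. The cell depends on \<open>z\<close> but not on the grid function.\<close>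

lemma bilinearE:
  assumes "z \<in> closure \<Omega>"
  obtains i j s t where "i \<le> N" "j \<le> N" "0 \<le> s" "s \<le> 1" "0 \<le> t" "t \<le> 1"
    and "fst z = fst p + (real i + s) * h" and "snd z = snd p + (real j + t) * h"
    and "\<And>U. bilinear p h N U z = (1 - s) * (1 - t) * U i j + s * (1 - t) * U (i + 1) j
      + (1 - s) * t * U i (j + 1) + s * t * U (i + 1) (j + 1)"
proof -
  define \<xi> where "\<xi> = (fst z - fst p) / h"
  define \<zeta> where "\<zeta> = (snd z - snd p) / h"
  define i where "i = min N (nat \<lfloor>\<xi>\<rfloor>)"
  define j where "j = min N (nat \<lfloor>\<zeta>\<rfloor>)"
  have "0 \<le> \<xi>" "\<xi> \<le> real (N + 1)" "0 \<le> \<zeta>" "\<zeta> \<le> real (N + 1)"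
    using assms mesh_pos unfolding closure_square \<xi>_def \<zeta>_def
    by (auto simp: mem_Times_iff pos_divide_le_eq algebra_simps)
  note cells = bilinear_cell[OF this(1,2) i_def] bilinear_cell[OF this(3,4) j_def]
  show thesis
  proof (rule that[of i j "\<xi> - real i" "\<zeta> - real j"])
    show "fst z = fst p + (real i + (\<xi> - real i)) * h" "snd z = snd p + (real j + (\<zeta> - real j)) * h"
      using mesh_pos by (auto simp: \<xi>_def \<zeta>_def)
    show "bilinear p h N U z = (1 - (\<xi> - real i)) * (1 - (\<zeta> - real j)) * U i j
      + (\<xi> - real i) * (1 - (\<zeta> - real j)) * U (i + 1) j
      + (1 - (\<xi> - real i)) * (\<zeta> - real j) * U i (j + 1)
      + (\<xi> - real i) * (\<zeta> - real j) * U (i + 1) (j + 1)" for U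
      unfolding bilinear_def Let_def i_def j_def \<xi>_def \<zeta>_def by (rule refl)
  qed (use cells in auto)
qed

lemma bilinear_ge_min:
  assumes "z \<in> closure \<Omega>" and U: "\<And>k l. k \<le> N + 1 \<Longrightarrow> l \<le> N + 1 \<Longrightarrow> m \<le> U k l"
  shows "m \<le> bilinear p h N U z"
proof -
  obtain i j s t where ij: "i \<le> N" "j \<le> N" and st: "0 \<le> s" "s \<le> 1" "0 \<le> t" "t \<le> 1"
    and b: "\<And>U. bilinear p h N U z = (1 - s) * (1 - t) * U i j + s * (1 - t) * U (i + 1) j
      + (1 - s) * t * U i (j + 1) + s * t * U (i + 1) (j + 1)"
    using bilinearE[OF assms(1)] by metis
  have "m = (1 - s) * (1 - t) * m + s * (1 - t) * m + (1 - s) * t * m + s * t * m"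
    by (simp add: algebra_simps)
  also have "\<dots> \<le> bilinear p h N U z"
    unfolding b using st ij by (intro add_mono mult_left_mono U) auto
  finally show ?thesis .
qed

text \<open>Linear interpolation of the square function on a cell of length \<open>h\<close> exceeds it by
  \<open>s * (1 - s) * h\<^sup>2\<close>, and the two coordinates contribute additively.\<close>

lemma bilinear_sq_dist_ge:
  assumes "z \<in> closure \<Omega>"
  shows "sq_dist z \<le> bilinear p h N (\<lambda>i j. sq_dist (grid_point p h i j)) z"
proof -
  obtain i j s t where st: "0 \<le> s" "s \<le> 1" "0 \<le> t" "t \<le> 1"
    and z: "fst z = fst p + (real i + s) * h" "snd z = snd p + (real j + t) * h"
    and b: "\<And>U. bilinear p h N U z = (1 - s) * (1 - t) * U i j + s * (1 - t) * U (i + 1) j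
      + (1 - s) * t * U i (j + 1) + s * t * U (i + 1) (j + 1)"
    using bilinearE[OF assms] by metis
  have "bilinear p h N (\<lambda>i j. sq_dist (grid_point p h i j)) z - sq_dist z
      = (s * (1 - s) + t * (1 - t)) * h\<^sup>2"
    unfolding b sq_dist_def z grid_point_def by (simp add: power2_eq_square algebra_simps)
  moreover have "0 \<le> (s * (1 - s) + t * (1 - t)) * h\<^sup>2" using st by simp
  ultimately show ?thesis by linarith
qed

section \<open>The second-order part of the scheme\<close>

text \<open>With the source replaced by \<open>0\<close>, the operator is linear in the pair of boundary data and grid
  function. The boundary data enter only at the ends of the cut-off arms, and they are kept
  independent of the grid function so that barriers can be added to both.\<close>

abbreviation diffusion ::
  "(real \<times> real \<Rightarrow> real) \<Rightarrow> real \<times> real \<Rightarrow> (nat \<Rightarrow> nat \<Rightarrow> real) \<Rightarrow> nat \<Rightarrow> nat \<Rightarrow> real" where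
  "diffusion \<equiv> discrete_op \<Omega> p h N (\<lambda>_. 0)"

lemma discrete_op_eq_diffusion:
  "discrete_op \<Omega> p h N f g (a, \<theta>) U i j
    = diffusion g (a, \<theta>) U i j + 2 * sqrt (a * (1 - a) * f (grid_point p h i j))"
  by (simp add: discrete_op_def)

lemma arm_value_lincomb:
  "arm_value \<Omega> p h N (\<lambda>x. r * \<gamma> x + s * \<gamma>' x + t) (\<lambda>i j. r * U i j + s * U' i j + t) x e
    = r * arm_value \<Omega> p h N \<gamma> U x e + s * arm_value \<Omega> p h N \<gamma>' U' x e + t"
  by (simp add: arm_value_def bilinear_def Let_def algebra_simps)

lemma delta_dir_lincomb:
  "delta_dir \<Omega> p h N (\<lambda>x. r * \<gamma> x + s * \<gamma>' x + t) (\<lambda>i j. r * U i j + s * U' i j + t) e i j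
    = r * delta_dir \<Omega> p h N \<gamma> U e i j + s * delta_dir \<Omega> p h N \<gamma>' U' e i j"
proof -
  \<comment> \<open>The constant \<open>t\<close> drops out of each one-sided difference quotient.\<close>
  have quot: "(r * v + s * v' + t - (r * w + s * w' + t)) / \<eta> = r * ((v - w) / \<eta>) + s * ((v' - w') / \<eta>)"
    for v v' w w' \<eta> :: real
    by (simp add: add_divide_distrib diff_divide_distrib right_diff_distrib)
  show ?thesis
    unfolding delta_dir_def arm_value_lincomb Let_def quot by (simp only: algebra_simps)
qed

lemma diffusion_lincomb:
  "diffusion (\<lambda>x. r * \<gamma> x + s * \<gamma>' x + t) c (\<lambda>i j. r * U i j + s * U' i j + t) i j
    = r * diffusion \<gamma> c U i j + s * diffusion \<gamma>' c U' i j"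
proof -
  have xx: "delta_xx h (\<lambda>i j. r * U i j + s * U' i j + t) i j
      = r * delta_xx h U i j + s * delta_xx h U' i j"
    by (simp add: delta_xx_def diff_divide_distrib add_divide_distrib algebra_simps)
  have yy: "delta_yy h (\<lambda>i j. r * U i j + s * U' i j + t) i j
      = r * delta_yy h U i j + s * delta_yy h U' i j"
    by (simp add: delta_yy_def diff_divide_distrib add_divide_distrib algebra_simps)
  have xy: "delta_xy h \<alpha> (\<lambda>i j. r * U i j + s * U' i j + t) i j
      = r * delta_xy h \<alpha> U i j + s * delta_xy h \<alpha> U' i j" for \<alpha>
    by (simp add: delta_xy_def diff_divide_distrib add_divide_distrib algebra_simps)
  show ?thesis
    unfolding discrete_op_def xx yy xy delta_dir_lincomb
    by (simp add: algebra_simps split: prod.split)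
qed

lemma delta_dir_nonneg_at_min:
  assumes x: "grid_point p h i j \<in> \<Omega>"
    and U: "\<And>k l. k \<le> N + 1 \<Longrightarrow> l \<le> N + 1 \<Longrightarrow> U i j \<le> U k l"
    and \<gamma>: "\<And>y. y \<in> frontier \<Omega> \<Longrightarrow> U i j \<le> \<gamma> y"
  shows "0 \<le> delta_dir \<Omega> p h N \<gamma> U e i j"
proof -
  have v: "U i j \<le> arm_value \<Omega> p h N \<gamma> U (grid_point p h i j) d" for d
    using arm_cut_off(2)[OF x, of d] by (auto simp: arm_value_def intro!: bilinear_ge_min U \<gamma>)
  have "0 \<le> (arm_value \<Omega> p h N \<gamma> U (grid_point p h i j) e - U i j) / arm \<Omega> h (grid_point p h i j) e"
    "(U i j - arm_value \<Omega> p h N \<gamma> U (grid_point p h i j) (- e)) / arm \<Omega> h (grid_point p h i j) (- e) \<le> 0"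
    using v[of e] v[of "- e"] arm_pos[OF x, of e] arm_pos[OF x, of "- e"]
    by (intro divide_nonneg_pos divide_nonpos_pos; simp)+
  then show ?thesis
    unfolding delta_dir_def Let_def using arm_pos[OF x, of e] arm_pos[OF x, of "- e"]
    by (intro mult_nonneg_nonneg) simp_all
qed

text \<open>Monotonicity of the scheme. In the 7-point stencil the mixed difference takes \<open>\<bar>\<alpha>\<^sub>1\<^sub>2\<bar>\<close> away from
  the weight of each axis neighbour; the condition for choosing that stencil says exactly that what
  is left is non-negative.\<close>

lemma diffusion_nonpos_at_min:
  assumes c: "c \<in> control_set" and ij: "i \<in> {1..N}" "j \<in> {1..N}"
    and U: "\<And>k l. k \<le> N + 1 \<Longrightarrow> l \<le> N + 1 \<Longrightarrow> U i j \<le> U k l"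
    and \<gamma>: "\<And>y. y \<in> frontier \<Omega> \<Longrightarrow> U i j \<le> \<gamma> y"
  shows "diffusion \<gamma> c U i j \<le> 0"
proof -
  obtain a \<theta> where c': "c = (a, \<theta>)" and a: "0 \<le> a" "a \<le> 1"
    using c by (auto simp: control_set_def)
  show ?thesis
  proof (cases "\<bar>alpha12 a \<theta>\<bar> \<le> alpha11 a \<theta> \<and> \<bar>alpha12 a \<theta>\<bar> \<le> alpha22 a \<theta>")
    case True
    define \<alpha> where "\<alpha> = alpha12 a \<theta>"
    define d where "d k l = U k l - U i j" for k l
    have d: "0 \<le> d k l" if "k \<le> N + 1" "l \<le> N + 1" for k l
      using U[OF that] by (simp add: d_def)
    have pos: "0 \<le> d (i + 1) j" "0 \<le> d (i - 1) j" "0 \<le> d i (j + 1)" "0 \<le> d i (j - 1)"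
      "0 \<le> d (i + 1) (j + 1)" "0 \<le> d (i - 1) (j - 1)" "0 \<le> d (i + 1) (j - 1)" "0 \<le> d (i - 1) (j + 1)"
      using ij by (auto intro!: d)
    \<comment> \<open>The differences towards the axis neighbours carry the weights \<open>\<alpha>\<^sub>1\<^sub>1 - \<bar>\<alpha>\<^sub>1\<^sub>2\<bar>\<close> and
      \<open>\<alpha>\<^sub>2\<^sub>2 - \<bar>\<alpha>\<^sub>1\<^sub>2\<bar>\<close>, those towards the two diagonal neighbours the weight \<open>\<bar>\<alpha>\<^sub>1\<^sub>2\<bar>\<close>.\<close>
    have "diffusion \<gamma> c U i j =
        - ((alpha11 a \<theta> - \<bar>\<alpha>\<bar>) * (d (i + 1) j + d (i - 1) j)
          + (alpha22 a \<theta> - \<bar>\<alpha>\<bar>) * (d i (j + 1) + d i (j - 1))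
          + \<bar>\<alpha>\<bar> * (if 0 \<le> \<alpha> then d (i + 1) (j + 1) + d (i - 1) (j - 1)
                  else d (i + 1) (j - 1) + d (i - 1) (j + 1))) / h\<^sup>2"
      using True mesh_pos unfolding c' discrete_op_def prod.case if_P[OF True] \<alpha>_def[symmetric]
      by (simp add: delta_xx_def delta_yy_def delta_xy_def d_def field_simps)
    moreover have "0 \<le> (alpha11 a \<theta> - \<bar>\<alpha>\<bar>) * (d (i + 1) j + d (i - 1) j)
          + (alpha22 a \<theta> - \<bar>\<alpha>\<bar>) * (d i (j + 1) + d i (j - 1))
          + \<bar>\<alpha>\<bar> * (if 0 \<le> \<alpha> then d (i + 1) (j + 1) + d (i - 1) (j - 1)
                  else d (i + 1) (j - 1) + d (i - 1) (j + 1))"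
      using pos True unfolding \<alpha>_def by (intro add_nonneg_nonneg mult_nonneg_nonneg) auto
    ultimately show ?thesis by (simp add: divide_nonpos_nonneg)
  next
    case False
    have dd: "0 \<le> delta_dir \<Omega> p h N \<gamma> U e i j" for e
      using square_grid_fits(4)[OF grid ij] U \<gamma> by (rule delta_dir_nonneg_at_min)
    have "0 \<le> a * delta_dir \<Omega> p h N \<gamma> U (cos \<theta>, - sin \<theta>) i j"
      "0 \<le> (1 - a) * delta_dir \<Omega> p h N \<gamma> U (sin \<theta>, cos \<theta>) i j"
      using a dd by auto
    then show ?thesis unfolding c' discrete_op_def prod.case if_not_P[OF False] by simp
  qed
qed

text \<open>Along a unit direction \<open>\<bar>x + r e\<bar>\<^sup>2\<close> is a quadratic in \<open>r\<close> with leading coefficient \<open>1\<close>, on which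
  the divided difference with unequal arms is exactly \<open>2\<close>. Interpolated arm values can only be too
  large.\<close>

lemma delta_dir_sq_dist_ge:
  assumes x: "grid_point p h i j \<in> \<Omega>" and e: "(fst e)\<^sup>2 + (snd e)\<^sup>2 = 1"
  shows "2 \<le> delta_dir \<Omega> p h N sq_dist (\<lambda>i j. sq_dist (grid_point p h i j)) e i j"
proof -
  define z where "z = grid_point p h i j"
  define v where "v = arm_value \<Omega> p h N sq_dist (\<lambda>i j. sq_dist (grid_point p h i j)) z"
  define b where "b = fst z * fst e + snd z * snd e"
  define \<eta> where "\<eta> = arm \<Omega> h z e"
  define \<eta>' where "\<eta>' = arm \<Omega> h z (- e)"
  have pos: "0 < \<eta>" "0 < \<eta>'" using arm_pos[OF x] by (auto simp: \<eta>_def \<eta>'_def z_def)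
  have v: "sq_dist (z + arm \<Omega> h z d *\<^sub>R d) \<le> v d" for d
    by (auto simp: v_def arm_value_def arm_def intro: bilinear_sq_dist_ge)
  have ray: "sq_dist (z + r *\<^sub>R e) = sq_dist z + 2 * r * b + r\<^sup>2" for r
  proof -
    have "sq_dist (z + r *\<^sub>R e) = sq_dist z + 2 * r * b + r\<^sup>2 * ((fst e)\<^sup>2 + (snd e)\<^sup>2)"
      by (simp add: sq_dist_def b_def power2_eq_square algebra_simps)
    then show ?thesis by (simp add: e)
  qed
  have "\<eta> * (2 * b + \<eta>) \<le> v e - sq_dist z"
    using v[of e] ray[of \<eta>] by (simp add: \<eta>_def power2_eq_square algebra_simps)
  then have fwd: "2 * b + \<eta> \<le> (v e - sq_dist z) / \<eta>"
    using pos by (simp add: pos_le_divide_eq mult.commute)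
  have "sq_dist z - v (- e) \<le> \<eta>' * (2 * b - \<eta>')"
    using v[of "- e"] ray[of "- \<eta>'"] by (simp add: \<eta>'_def power2_eq_square algebra_simps)
  then have bwd: "(sq_dist z - v (- e)) / \<eta>' \<le> 2 * b - \<eta>'"
    using pos by (simp add: pos_divide_le_eq mult.commute)
  have "\<eta> + \<eta>' \<noteq> 0" using pos by simp
  then have "2 = 2 / (\<eta> + \<eta>') * (\<eta> + \<eta>')" by (metis nonzero_eq_divide_eq)
  also have "\<dots> \<le> 2 / (\<eta> + \<eta>') * ((v e - sq_dist z) / \<eta> - (sq_dist z - v (- e)) / \<eta>')"
    using fwd bwd pos by (intro mult_left_mono) auto
  also have "\<dots> = delta_dir \<Omega> p h N sq_dist (\<lambda>i j. sq_dist (grid_point p h i j)) e i j"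
    by (simp add: delta_dir_def Let_def v_def \<eta>_def \<eta>'_def z_def)
  finally show ?thesis .
qed

lemma diffusion_sq_dist_le:
  assumes c: "c \<in> control_set" and ij: "i \<in> {1..N}" "j \<in> {1..N}"
  shows "diffusion sq_dist c (\<lambda>i j. sq_dist (grid_point p h i j)) i j \<le> - 2"
proof -
  obtain a \<theta> where c': "c = (a, \<theta>)" and a: "0 \<le> a" "a \<le> 1"
    using c by (auto simp: control_set_def)
  let ?Q = "\<lambda>i j. sq_dist (grid_point p h i j)"
  show ?thesis
  proof (cases "\<bar>alpha12 a \<theta>\<bar> \<le> alpha11 a \<theta> \<and> \<bar>alpha12 a \<theta>\<bar> \<le> alpha22 a \<theta>")
    case True
    have h: "h \<noteq> 0" using mesh_pos by simp
    have pred: "real (i - Suc 0) = real i - 1" "real (j - Suc 0) = real j - 1" using ij by auto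
    have xx: "delta_xx h ?Q i j = 2" and yy: "delta_yy h ?Q i j = 2"
      and xy: "delta_xy h \<alpha> ?Q i j = 0" for \<alpha>
      using h by (simp_all add: delta_xx_def delta_yy_def delta_xy_def sq_dist_def grid_point_def pred
          divide_simps power2_eq_square) (simp_all add: algebra_simps)
    have "alpha11 a \<theta> + alpha22 a \<theta> = 1" by (simp add: alpha11_def alpha22_def field_simps)
    then show ?thesis
      unfolding c' discrete_op_def prod.case if_P[OF True] xx yy xy by simp
  next
    case False
    have "a * 2 \<le> a * delta_dir \<Omega> p h N sq_dist ?Q (cos \<theta>, - sin \<theta>) i j"
      "(1 - a) * 2 \<le> (1 - a) * delta_dir \<Omega> p h N sq_dist ?Q (sin \<theta>, cos \<theta>) i j"
      using a square_grid_fits(4)[OF grid ij] by (intro mult_left_mono delta_dir_sq_dist_ge; simp)+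
    then show ?thesis unfolding c' discrete_op_def prod.case if_not_P[OF False] by simp
  qed
qed

section \<open>Comparison and the barrier\<close>

text \<open>At a negative minimum over all grid nodes, which has to be interior, the boundary data are
  above the minimum as well, so monotonicity contradicts strict positivity for every control. The
  control may therefore be chosen separately at each node.\<close>

lemma discrete_minimum_principle:
  assumes \<gamma>: "\<And>y. y \<in> frontier \<Omega> \<Longrightarrow> 0 \<le> \<gamma> y"
    and bd: "\<And>k l. k \<le> N + 1 \<Longrightarrow> l \<le> N + 1 \<Longrightarrow> k \<in> {0, N + 1} \<or> l \<in> {0, N + 1} \<Longrightarrow> 0 \<le> U k l"
    and pos: "\<And>k l. k \<in> {1..N} \<Longrightarrow> l \<in> {1..N} \<Longrightarrow> \<exists>c\<in>control_set. 0 < diffusion \<gamma> c U k l"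
    and ij: "i \<le> N + 1" "j \<le> N + 1"
  shows "0 \<le> U i j"
proof (rule ccontr)
  assume neg: "\<not> 0 \<le> U i j"
  define S where "S = {..N + 1} \<times> {..N + 1}"
  have S: "finite S" "S \<noteq> {}" by (auto simp: S_def)
  obtain k l where arg: "arg_min_on (\<lambda>(k, l). U k l) S = (k, l)" by (rule prod.exhaust)
  have kl: "k \<le> N + 1" "l \<le> N + 1"
    using arg_min_if_finite(1)[OF S, of "\<lambda>(k, l). U k l"] unfolding arg by (auto simp: S_def)
  have least: "U k l \<le> U k' l'" if "k' \<le> N + 1" "l' \<le> N + 1" for k' l'
    using arg_min_least[OF S, of "(k', l')" "\<lambda>(k, l). U k l"] that unfolding arg by (auto simp: S_def)
  have m: "U k l < 0" using least[OF ij] neg by linarith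
  have "\<not> (k \<in> {0, N + 1} \<or> l \<in> {0, N + 1})" using bd[OF kl] m by linarith
  then have int: "k \<in> {1..N}" "l \<in> {1..N}" using kl by (simp_all add: Suc_le_eq)
  obtain c where c: "c \<in> control_set" "0 < diffusion \<gamma> c U k l" using pos[OF int] by blast
  have "U k l \<le> \<gamma> y" if "y \<in> frontier \<Omega>" for y using \<gamma>[OF that] m by linarith
  from diffusion_nonpos_at_min[of c k l U \<gamma>, OF c(1) int least this] c(2) show False by linarith
qed

text \<open>The grid function \<open>s * U\<close> is compared with minus the paraboloid; \<open>s = 1\<close> serves the lower and
  \<open>s = - 1\<close> the upper bound on the solution.\<close>

lemma barrier_lower_bound:
  assumes R: "\<And>y. y \<in> closure \<Omega> \<Longrightarrow> sq_dist y \<le> R2"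
    and G: "\<And>y. y \<in> frontier \<Omega> \<Longrightarrow> \<bar>g y\<bar> \<le> G"
    and bd: "\<And>k l. k \<le> N + 1 \<Longrightarrow> l \<le> N + 1 \<Longrightarrow> k \<in> {0, N + 1} \<or> l \<in> {0, N + 1} \<Longrightarrow>
      U k l = g (grid_point p h k l)"
    and K: "0 \<le> K" and s: "\<bar>s\<bar> \<le> 1"
    and super: "\<And>k l. k \<in> {1..N} \<Longrightarrow> l \<in> {1..N} \<Longrightarrow>
      \<exists>c\<in>control_set. - K < s * diffusion g c U k l"
    and ij: "i \<in> {1..N}" "j \<in> {1..N}"
  shows "- (1 / 2 * K * R2 + G) \<le> s * U i j"
proof -
  \<comment> \<open>The sum of \<open>s * u\<close> and the barrier \<open>K / 2 * (R2 - sq_dist) + G\<close>, as boundary data and as a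
    grid function.\<close>
  define \<gamma> where "\<gamma> = (\<lambda>x. s * g x + (- K / 2) * sq_dist x + (K / 2 * R2 + G))"
  define W where "W = (\<lambda>i j. s * U i j + (- K / 2) * sq_dist (grid_point p h i j) + (K / 2 * R2 + G))"
  have nonneg: "0 \<le> \<gamma> y" if y: "y \<in> frontier \<Omega>" for y
  proof -
    have "\<bar>s * g y\<bar> \<le> 1 * \<bar>g y\<bar>" unfolding abs_mult using s by (intro mult_right_mono) auto
    moreover have "K / 2 * sq_dist y \<le> K / 2 * R2"
      using R y K by (intro mult_left_mono) (auto simp: frontier_def)
    ultimately show ?thesis using G[OF y] by (simp add: \<gamma>_def)
  qed
  have "0 \<le> W i j"
  proof (rule discrete_minimum_principle[of \<gamma>])
    show "0 \<le> W k l" if "k \<le> N + 1" "l \<le> N + 1" "k \<in> {0, N + 1} \<or> l \<in> {0, N + 1}" for k l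
      using nonneg[OF square_grid_fits(5)[OF grid that]] bd[OF that] by (simp add: W_def \<gamma>_def)
    show "\<exists>c\<in>control_set. 0 < diffusion \<gamma> c W k l" if kl: "k \<in> {1..N}" "l \<in> {1..N}" for k l
    proof -
      obtain c where c: "c \<in> control_set" "- K < s * diffusion g c U k l" using super[OF kl] by auto
      have "K / 2 * diffusion sq_dist c (\<lambda>i j. sq_dist (grid_point p h i j)) k l \<le> K / 2 * - 2"
        using diffusion_sq_dist_le[OF c(1) kl] K by (intro mult_left_mono) auto
      then have "0 < diffusion \<gamma> c W k l"
        using c(2) unfolding \<gamma>_def W_def diffusion_lincomb by simp
      then show ?thesis using c(1) by auto
    qed
  qed (use nonneg ij in auto)
  moreover have "0 \<le> K / 2 * sq_dist (grid_point p h i j)" using K by (simp add: sq_dist_def)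
  ultimately show ?thesis by (simp add: W_def)
qed

lemma discrete_solution_subsolution:
  assumes u: "discrete_solution \<Omega> p h N f g u" and ij: "i \<in> {1..N}" "j \<in> {1..N}"
    and c: "c \<in> control_set"
  shows "discrete_op \<Omega> p h N f g c (grid_fun p h N g u) i j \<le> 0"
proof -
  let ?r = "\<lambda>c. vec_index (scheme_matrix \<Omega> p h N f g c *\<^sub>v u - scheme_rhs \<Omega> p h N f g c) (row_of N (i, j))"
  have carr: "u \<in> carrier_vec (N * N)"
    and sup: "(SUP c\<in>admissible_controls N. ereal (?r c)) = 0"
    using u node_row(1)[OF ij] by (auto simp: discrete_solution_def)
  have "(\<lambda>_. c) \<in> admissible_controls N" using c by (simp add: admissible_controls_def)
  then have "ereal (?r (\<lambda>_. c)) \<le> 0" using SUP_upper sup by (metis (lifting))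
  then show ?thesis
    unfolding scheme_matrix_form[OF carr ij] by (simp add: scheme_def zero_ereal_def)
qed

text \<open>The supremum over the controls may fail to be attained, since the scheme can jump in the angle
  where the stencil switches and where a cut-off arm meets a discontinuity of \<open>g\<close>; but an almost
  optimal control always exists.\<close>

lemma discrete_solution_supersolution:
  assumes u: "discrete_solution \<Omega> p h N f g u" and ij: "i \<in> {1..N}" "j \<in> {1..N}"
    and \<epsilon>: "0 < \<epsilon>"
  shows "\<exists>c\<in>control_set. - \<epsilon> < discrete_op \<Omega> p h N f g c (grid_fun p h N g u) i j"
proof -
  let ?r = "\<lambda>c. vec_index (scheme_matrix \<Omega> p h N f g c *\<^sub>v u - scheme_rhs \<Omega> p h N f g c) (row_of N (i, j))"
  have carr: "u \<in> carrier_vec (N * N)"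
    and sup: "(SUP c\<in>admissible_controls N. ereal (?r c)) = 0"
    using u node_row(1)[OF ij] by (auto simp: discrete_solution_def)
  have "ereal (- \<epsilon>) < (SUP c\<in>admissible_controls N. ereal (?r c))"
    unfolding sup using \<epsilon> by simp
  then obtain c where c: "c \<in> admissible_controls N" "- \<epsilon> < ?r c"
    by (auto simp: less_SUP_iff)
  then have "c (i, j) \<in> control_set" using ij by (auto simp: admissible_controls_def)
  moreover have "- \<epsilon> < discrete_op \<Omega> p h N f g (c (i, j)) (grid_fun p h N g u) i j"
    using c(2) unfolding scheme_matrix_form[OF carr ij] by (simp add: scheme_def)
  ultimately show ?thesis by blast
qed

end

section \<open>The data and the sup-norm bound\<close>

lemma source_bounds:
  assumes "(a, \<theta>) \<in> control_set" and "0 \<le> y"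
  shows "0 \<le> 2 * sqrt (a * (1 - a) * y)" and "2 * sqrt (a * (1 - a) * y) \<le> sqrt y"
proof -
  have a: "0 \<le> a" "a \<le> 1" using assms(1) by (auto simp: control_set_def)
  then show "0 \<le> 2 * sqrt (a * (1 - a) * y)" using assms(2) by simp
  have "0 \<le> (2 * a - 1)\<^sup>2" by simp
  then have "4 * (a * (1 - a)) \<le> 1" by (simp add: power2_eq_square algebra_simps)
  then have "4 * (a * (1 - a)) * y \<le> 1 * y" using assms(2) by (intro mult_right_mono)
  then have "sqrt (4 * (a * (1 - a) * y)) \<le> sqrt y" by (simp add: mult.assoc)
  then show "2 * sqrt (a * (1 - a) * y) \<le> sqrt y" by (simp add: real_sqrt_mult)
qed

lemma abs_le_sup_norm_on: "bounded (\<phi> ` S) \<Longrightarrow> x \<in> S \<Longrightarrow> \<bar>\<phi> x\<bar> \<le> sup_norm_on S \<phi>"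
  unfolding sup_norm_on_def
  by (rule cSUP_upper) (auto simp: bounded_iff bdd_above_def)

lemma sq_dist_le_radius:
  assumes "bounded S" "z \<in> S"
  shows "sq_dist z \<le> (SUP (x, y)\<in>S. sqrt (x\<^sup>2 + y\<^sup>2))\<^sup>2"
proof -
  have eq: "(\<lambda>(x, y). sqrt (x\<^sup>2 + y\<^sup>2)) = (norm :: real \<times> real \<Rightarrow> real)"
    by (auto simp: norm_prod_def)
  have "norm z \<le> (SUP y\<in>S. norm y)"
    using assms by (intro cSUP_upper) (auto simp: bounded_iff bdd_above_def)
  then have "(norm z)\<^sup>2 \<le> (SUP y\<in>S. norm y)\<^sup>2" by (intro power_mono) auto
  then show ?thesis unfolding eq by (simp add: norm_prod_def sq_dist_def)
qed

theorem lemma7: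
  fixes \<Omega> :: "(real \<times> real) set" and f g :: "real \<times> real \<Rightarrow> real"
    and p :: "real \<times> real" and h :: real and N :: nat and u :: "real vec"
  assumes "square_grid \<Omega> p h N"
    and "\<And>x. x \<in> \<Omega> \<Longrightarrow> 0 \<le> f x"
    and "bounded (f ` \<Omega>)"
    and "bounded (g ` frontier \<Omega>)"
    and "\<And>c. c \<in> admissible_controls N \<Longrightarrow> M_matrix (scheme_matrix \<Omega> p h N f g c)"
    and "discrete_solution \<Omega> p h N f g u"
  shows "sup_norm_on {..<N * N} (vec_index u)
    \<le> 1 / 2 * sup_norm_on \<Omega> (\<lambda>x. sqrt (f x)) * (SUP (x, y)\<in>closure \<Omega>. sqrt (x\<^sup>2 + y\<^sup>2))\<^sup>2
      + sup_norm_on (frontier \<Omega>) g"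
proof -
  define F where "F = sup_norm_on \<Omega> (\<lambda>x. sqrt (f x))"
  define G where "G = sup_norm_on (frontier \<Omega>) g"
  define R where "R = (SUP (x, y)\<in>closure \<Omega>. sqrt (x\<^sup>2 + y\<^sup>2))"
  define U where "U = grid_fun p h N g u"
  note grid = assms(1) and u = assms(6)
  have N: "1 \<le> N" using grid by (simp add: square_grid_def)
  have R: "sq_dist y \<le> R\<^sup>2" if "y \<in> closure \<Omega>" for y
    unfolding R_def using that square_grid_fits(2)[OF grid]
    by (intro sq_dist_le_radius) (auto simp: bounded_closure)
  have G: "\<bar>g y\<bar> \<le> G" if "y \<in> frontier \<Omega>" for y
    unfolding G_def using assms(4) that by (rule abs_le_sup_norm_on)
  have F: "sqrt (f x) \<le> F" if "x \<in> \<Omega>" for x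
  proof -
    obtain B where "\<And>x. x \<in> \<Omega> \<Longrightarrow> \<bar>f x\<bar> \<le> B" using assms(3) by (auto simp: bounded_iff)
    then have "bounded ((\<lambda>x. sqrt (f x)) ` \<Omega>)"
      unfolding bounded_iff using assms(2) by (intro exI[of _ "sqrt B"]) fastforce
    from abs_le_sup_norm_on[OF this that] show ?thesis by (simp add: F_def)
  qed
  have node: "grid_point p h i j \<in> \<Omega>" if "i \<in> {1..N}" "j \<in> {1..N}" for i j
    using square_grid_fits(4)[OF grid that] .
  have F0: "0 \<le> F"
    using F[OF node[of 1 1]] assms(2)[OF node[of 1 1]] N by (auto intro: order_trans[OF real_sqrt_ge_zero])
  have bd: "U k l = g (grid_point p h k l)" if "k \<le> N + 1" "l \<le> N + 1" "k \<in> {0, N + 1} \<or> l \<in> {0, N + 1}" for k l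
    using that by (auto simp: U_def grid_fun_def)
  \<comment> \<open>The margin \<open>K - F\<close> pays for the control being only almost optimal.\<close>
  have bound: "\<bar>U i j\<bar> \<le> 1 / 2 * K * R\<^sup>2 + G" if K: "F < K" and ij: "i \<in> {1..N}" "j \<in> {1..N}" for K i j
  proof -
    have K0: "0 \<le> K" using K F0 by simp
    have "\<exists>c\<in>control_set. - K < 1 * discrete_op \<Omega> p h N (\<lambda>_. 0) g c U k l"
      if kl: "k \<in> {1..N}" "l \<in> {1..N}" for k l
    proof -
      obtain a \<theta> where c: "(a, \<theta>) \<in> control_set"
        and "- (K - F) < discrete_op \<Omega> p h N f g (a, \<theta>) U k l"
        using discrete_solution_supersolution[OF grid u kl, of "K - F"] K by (auto simp: U_def)
      moreover have "2 * sqrt (a * (1 - a) * f (grid_point p h k l)) \<le> F"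
        using source_bounds(2)[OF c assms(2)[OF node[OF kl]]] F[OF node[OF kl]] by linarith
      ultimately have "- K < 1 * discrete_op \<Omega> p h N (\<lambda>_. 0) g (a, \<theta>) U k l"
        unfolding discrete_op_eq_diffusion[OF grid, of f] by linarith
      then show ?thesis using c by blast
    qed
    from barrier_lower_bound[OF grid R G bd K0 _ this ij]
    have lower: "- (1 / 2 * K * R\<^sup>2 + G) \<le> U i j" by simp
    have "\<exists>c\<in>control_set. - K < (- 1) * discrete_op \<Omega> p h N (\<lambda>_. 0) g c U k l"
      if kl: "k \<in> {1..N}" "l \<in> {1..N}" for k l
    proof -
      have c: "(0, 0) \<in> control_set" by (simp add: control_set_def)
      have "discrete_op \<Omega> p h N (\<lambda>_. 0) g (0, 0) U k l \<le> 0"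
        using discrete_solution_subsolution[OF grid u kl c]
          source_bounds(1)[OF c assms(2)[OF node[OF kl]]]
        unfolding discrete_op_eq_diffusion[OF grid, of f] U_def by linarith
      then show ?thesis using c K F0 by (intro bexI[of _ "(0, 0)"]) auto
    qed
    from barrier_lower_bound[OF grid R G bd K0 _ this ij]
    have "- (1 / 2 * K * R\<^sup>2 + G) \<le> - U i j" by simp
    with lower show ?thesis by linarith
  qed
  have "\<bar>vec_index u k\<bar> \<le> 1 / 2 * F * R\<^sup>2 + G" if k: "k < N * N" for k
  proof -
    obtain i j where n: "node_of N k = (i, j)" by (cases "node_of N k")
    have ij: "i \<in> {1..N}" "j \<in> {1..N}"
      using n k N by (auto simp: node_of_def less_mult_imp_div_less Suc_le_eq)
    have "vec_index u k = U i j" using ij row_node[OF k] n by (auto simp: U_def grid_fun_def)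
    moreover have "\<bar>U i j\<bar> \<le> 1 / 2 * F * R\<^sup>2 + G"
    proof (rule tendsto_lowerbound[of _ _ "at_right F"])
      show "((\<lambda>K. 1 / 2 * K * R\<^sup>2 + G) \<longlongrightarrow> 1 / 2 * F * R\<^sup>2 + G) (at_right F)"
        by (intro tendsto_intros)
      show "\<forall>\<^sub>F K in at_right F. \<bar>U i j\<bar> \<le> 1 / 2 * K * R\<^sup>2 + G"
        using bound[OF _ ij] by (auto simp: eventually_at_right_less eventually_at_filter)
    qed simp
    ultimately show ?thesis by simp
  qed
  then show ?thesis
    unfolding F_def[symmetric] G_def[symmetric] R_def[symmetric] sup_norm_on_def[of "{..<N * N}"]
    using N by (intro cSUP_least) (auto simp: lessThan_empty_iff)
qed

end
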